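(* Let $(X,\mathcal{A},\mu)$ be a measure space with $\mu(X)>0$ such that $X$ is not an atom. Then the comaximal graph $\Gamma'_2(\mathcal{M}(X,\mathcal{A}))$ is not hypertriangulated.
   Context: $\mathcal{M}(X,\mathcal{A})$ is the commutative ring (pointwise operations) of all $\mathcal{A}$-measurable functions $f:X\to\mathbb{R}$; $Z(f)=\{x\in X:f(x)=0\}$. A set $A\in\mathcal{A}$ is an atom if $\mu(A)>0$ and $A$ cannot be written as a disjoint union $A=B\sqcup C$ with $B,C\in\mathcal{A}$, $\mu(B)>0$, $\mu(C)>0$. A function $u\in\mathcal{M}(X,\mathcal{A})$ is a $\mu$-unit if $\mu(Z(u))=0$. Write $\mathscr{D}=\{f\in\mathcal{M}(X,\mathcal{A}):\mu(Z(f))>0\text{ and }\mu(X\setminus Z(f))>0\}$, i.e. the functions that are neither $\mu$-units nor equal to $0$ almost everywhere. The comaximal graph $\Gamma'_2(\mathcal{M}(X,\mathcal{A}))$ is the simple graph with vertex set $\mathscr{D}$ in which distinct $f,g$ are adjacent iff the sum of principal ideals $\langle f\rangle+\langle g\rangle$ equals $\langle u\rangle$ for some $\mu$-unit $u$. A graph is hypertriangulated if every edge is an edge of a triangle. *)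

theory Defs
  imports
    "HOL-Analysis.Analysis"
    "HOL-Algebra.Ideal"
    "Graph_Theory.Pair_Digraph"
begin

text \<open>
  The elements of the ring \<open>\<M>(X, \<A>)\<close> are functions with domain \<open>X = space M\<close>, which is
  represented by \<^const>\<open>extensional\<close>: two elements are equal iff they agree on \<open>X\<close>.
\<close>

definition measurable_ring :: "'a measure \<Rightarrow> ('a \<Rightarrow> real) ring" where
  "measurable_ring M =
    \<lparr> carrier = borel_measurable M \<inter> extensional (space M),
      mult = (\<lambda>f g. \<lambda>x\<in>space M. f x * g x),
      one = (\<lambda>x\<in>space M. 1),
      zero = (\<lambda>x\<in>space M. 0),
      add = (\<lambda>f g. \<lambda>x\<in>space M. f x + g x) \<rparr>"

definition zero_set :: "'a measure \<Rightarrow> ('a \<Rightarrow> real) \<Rightarrow> 'a set" where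
  "zero_set M f = {x \<in> space M. f x = 0}"

definition measure_atom :: "'a measure \<Rightarrow> 'a set \<Rightarrow> bool" where
  "measure_atom M A \<longleftrightarrow>
    A \<in> sets M \<and> emeasure M A > 0 \<and>
    \<not> (\<exists>B\<in>sets M. \<exists>C\<in>sets M. A = B \<union> C \<and> B \<inter> C = {} \<and> emeasure M B > 0 \<and> emeasure M C > 0)"

definition mu_unit :: "'a measure \<Rightarrow> ('a \<Rightarrow> real) \<Rightarrow> bool" where
  "mu_unit M u \<longleftrightarrow> u \<in> carrier (measurable_ring M) \<and> emeasure M (zero_set M u) = 0"

definition comaximal_verts :: "'a measure \<Rightarrow> ('a \<Rightarrow> real) set" where
  "comaximal_verts M =
    {f \<in> carrier (measurable_ring M).
      emeasure M (zero_set M f) > 0 \<and> emeasure M (space M - zero_set M f) > 0}"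

text \<open>
  A simple graph is represented by its symmetric, irreflexive set of arcs, i.e. as a
  \<^locale>\<open>pair_bidirected_digraph\<close>, which does not require finiteness.
\<close>

definition comaximal_graph :: "'a measure \<Rightarrow> ('a \<Rightarrow> real) pair_pre_digraph" where
  "comaximal_graph M =
    \<lparr> pverts = comaximal_verts M,
      parcs = {(f, g). f \<in> comaximal_verts M \<and> g \<in> comaximal_verts M \<and> f \<noteq> g \<and>
        (\<exists>u. mu_unit M u \<and>
          PIdl\<^bsub>measurable_ring M\<^esub> f <+>\<^bsub>measurable_ring M\<^esub> PIdl\<^bsub>measurable_ring M\<^esub> g
            = PIdl\<^bsub>measurable_ring M\<^esub> u)} \<rparr>"

definition triangle :: "'v pair_pre_digraph \<Rightarrow> 'v \<Rightarrow> 'v \<Rightarrow> 'v \<Rightarrow> bool" where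
  "triangle G u v w \<longleftrightarrow>
    u \<in> pverts G \<and> v \<in> pverts G \<and> w \<in> pverts G \<and>
    u \<noteq> v \<and> v \<noteq> w \<and> u \<noteq> w \<and> u \<rightarrow>\<^bsub>G\<^esub> v \<and> v \<rightarrow>\<^bsub>G\<^esub> w \<and> u \<rightarrow>\<^bsub>G\<^esub> w"

definition hypertriangulated :: "'v pair_pre_digraph \<Rightarrow> bool" where
  "hypertriangulated G \<longleftrightarrow> (\<forall>u v. u \<rightarrow>\<^bsub>G\<^esub> v \<longrightarrow> (\<exists>w. triangle G u v w))"

lemma cring_measurable_ring: "cring (measurable_ring M)"
proof (rule cringI)
  let ?R = "measurable_ring M"
  show "abelian_group ?R"
  proof (rule abelian_groupI)
    fix f assume f: "f \<in> carrier ?R"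
    show "\<exists>g\<in>carrier ?R. g \<oplus>\<^bsub>?R\<^esub> f = \<zero>\<^bsub>?R\<^esub>"
    proof (rule bexI)
      show "(\<lambda>x\<in>space M. - f x) \<in> carrier ?R"
        using f by (auto simp: measurable_ring_def cong: measurable_cong)
    qed (auto simp: measurable_ring_def restrict_def fun_eq_iff)
  qed (auto simp: measurable_ring_def restrict_def fun_eq_iff extensional_def
       cong: measurable_cong)
  show "comm_monoid ?R"
    by (rule comm_monoidI)
       (auto simp: measurable_ring_def restrict_def fun_eq_iff extensional_def
        cong: measurable_cong)
qed (auto simp: measurable_ring_def restrict_def fun_eq_iff distrib_right)

lemma pair_bidirected_digraph_comaximal_graph: "pair_bidirected_digraph (comaximal_graph M)"
proof -
  interpret cring "measurable_ring M" by (rule cring_measurable_ring)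
  have comm: "PIdl\<^bsub>measurable_ring M\<^esub> f <+>\<^bsub>measurable_ring M\<^esub> PIdl\<^bsub>measurable_ring M\<^esub> g
      = PIdl\<^bsub>measurable_ring M\<^esub> g <+>\<^bsub>measurable_ring M\<^esub> PIdl\<^bsub>measurable_ring M\<^esub> f"
    if "f \<in> comaximal_verts M" "g \<in> comaximal_verts M" for f g
    using that cgenideal_ideal
    by (intro set_add_comm) (auto simp: comaximal_verts_def dest: ideal.Icarr)
  show ?thesis
    by unfold_locales
       (auto simp: comaximal_graph_def symmetric_def sym_def comm)
qed

end

theory Submission
  imports Defs
begin

text \<open>
  If \<open>f\<close> and \<open>g\<close> are adjacent, then a \<open>\<mu>\<close>-unit is a combination of \<open>f\<close> and \<open>g\<close>, so
  \<open>Z(f) \<inter> Z(g)\<close> is null. Split \<open>X = B \<squnion> C\<close> into two sets of positive measure. The indicators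
  of \<open>B\<close> and \<open>C\<close> are adjacent, because they sum to \<open>1\<close>. A common neighbour \<open>w\<close> would have
  \<open>Z(w) \<inter> C\<close> and \<open>Z(w) \<inter> B\<close> null, hence \<open>Z(w)\<close> null, and so it would be a \<open>\<mu>\<close>-unit.
\<close>

text \<open>An ideal containing \<open>\<one>\<close> is the whole ring, so both sides equal
  \<open>carrier R\<close>. This makes the constant \<open>1\<close> the \<open>\<mu>\<close>-unit
  that witnesses adjacency.\<close>

lemma (in cring) PIdl_add_eq_PIdl_one:
  assumes "a \<in> carrier R" "b \<in> carrier R" "a \<oplus> b = \<one>"
  shows "PIdl a <+> PIdl b = PIdl \<one>"
proof -
  have "\<one> \<in> PIdl a <+> PIdl b"
    using assms cgenideal_self by (force simp: set_add_def')
  then have "PIdl a <+> PIdl b = carrier R"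
    using add_ideals[OF cgenideal_ideal cgenideal_ideal] assms ideal.one_imp_carrier by blast
  moreover have "PIdl \<one> = carrier R"
    using cgenideal_ideal cgenideal_self ideal.one_imp_carrier by blast
  ultimately show ?thesis by simp
qed

lemma sets_zero_set:
  assumes "f \<in> carrier (measurable_ring M)"
  shows "zero_set M f \<in> sets M"
  using assms unfolding zero_set_def measurable_ring_def by auto

lemma null_zero_sets_Int_if_arc:
  assumes "f \<rightarrow>\<^bsub>comaximal_graph M\<^esub> g"
  shows "zero_set M f \<inter> zero_set M g \<in> null_sets M"
proof -
  interpret cring "measurable_ring M" by (rule cring_measurable_ring)
  obtain u where f: "f \<in> carrier (measurable_ring M)" and g: "g \<in> carrier (measurable_ring M)"
    and u: "mu_unit M u"
    and eq: "PIdl\<^bsub>measurable_ring M\<^esub> f <+>\<^bsub>measurable_ring M\<^esub> PIdl\<^bsub>measurable_ring M\<^esub> g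
      = PIdl\<^bsub>measurable_ring M\<^esub> u"
    using assms by (auto simp: comaximal_graph_def comaximal_verts_def)
  have u_carrier: "u \<in> carrier (measurable_ring M)"
    using u by (simp add: mu_unit_def)
  then have "u \<in> PIdl\<^bsub>measurable_ring M\<^esub> f <+>\<^bsub>measurable_ring M\<^esub> PIdl\<^bsub>measurable_ring M\<^esub> g"
    using cgenideal_self eq by blast
  then obtain a b where "u = (a \<otimes>\<^bsub>measurable_ring M\<^esub> f) \<oplus>\<^bsub>measurable_ring M\<^esub> (b \<otimes>\<^bsub>measurable_ring M\<^esub> g)"
    by (auto simp: set_add_def' cgenideal_def)
  \<comment> \<open>At a common zero of \<open>f\<close> and \<open>g\<close> both products vanish,
    whatever the values of \<open>a\<close> and \<open>b\<close>.\<close>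
  then have "zero_set M f \<inter> zero_set M g \<subseteq> zero_set M u"
    by (auto simp: zero_set_def measurable_ring_def)
  moreover have "zero_set M u \<in> null_sets M"
    using u sets_zero_set[OF u_carrier] by (auto simp: mu_unit_def)
  \<comment> \<open>\<open>M\<close> may be incomplete: a subset of a null set is null once it is
    measurable, hence \<open>sets_zero_set\<close>.\<close>
  ultimately show ?thesis
    using sets_zero_set f g by (blast intro: null_sets_subset)
qed

theorem corollary3p19:
  fixes M :: "'a measure"
  assumes "emeasure M (space M) > 0"
    and "\<not> measure_atom M (space M)"
  shows "\<not> hypertriangulated (comaximal_graph M)"
proof
  assume hyper: "hypertriangulated (comaximal_graph M)"
  interpret cring "measurable_ring M" by (rule cring_measurable_ring)
  \<comment> \<open>A measurable set of positive measure can fail to be an atom only by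
    splitting.\<close>
  obtain B C where sets: "B \<in> sets M" "C \<in> sets M" and X: "space M = B \<union> C" and "B \<inter> C = {}"
    and pos: "emeasure M B > 0" "emeasure M C > 0"
    using assms sets.top[of M] unfolding measure_atom_def by blast
  \<comment> \<open>Restriction makes the indicators extensional, as the carrier demands.\<close>
  define f g :: "'a \<Rightarrow> real"
    where "f = restrict (indicator B) (space M)" and "g = restrict (indicator C) (space M)"
  have Z: "zero_set M f = C" "zero_set M g = B"
    using X \<open>B \<inter> C = {}\<close> by (auto simp: zero_set_def f_def g_def indicator_def)
  have carrier: "f \<in> carrier (measurable_ring M)" "g \<in> carrier (measurable_ring M)"
    using sets by (auto simp: f_def g_def measurable_ring_def cong: measurable_cong)
  have "space M - C = B" "space M - B = C"
    using X \<open>B \<inter> C = {}\<close> by auto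
  then have verts: "f \<in> comaximal_verts M" "g \<in> comaximal_verts M"
    using carrier pos by (auto simp: comaximal_verts_def Z)
  \<comment> \<open>Equality would force \<open>B = C\<close>, so both would be empty by
    disjointness.\<close>
  have "f \<noteq> g"
    using Z pos \<open>B \<inter> C = {}\<close> by auto
  moreover have "f \<oplus>\<^bsub>measurable_ring M\<^esub> g = \<one>\<^bsub>measurable_ring M\<^esub>"
    using X \<open>B \<inter> C = {}\<close>
    by (auto simp: measurable_ring_def f_def g_def indicator_def restrict_def fun_eq_iff)
  note PIdl_add_eq_PIdl_one[OF carrier this]
  moreover have "mu_unit M \<one>\<^bsub>measurable_ring M\<^esub>"
    by (auto simp: mu_unit_def zero_set_def) (simp add: measurable_ring_def)
  ultimately have "f \<rightarrow>\<^bsub>comaximal_graph M\<^esub> g"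
    using verts by (auto simp: comaximal_graph_def)
  then obtain w where w: "f \<rightarrow>\<^bsub>comaximal_graph M\<^esub> w" "g \<rightarrow>\<^bsub>comaximal_graph M\<^esub> w"
    using hyper by (auto simp: hypertriangulated_def triangle_def)
  have "(C \<inter> zero_set M w) \<union> (B \<inter> zero_set M w) \<in> null_sets M"
    using w[THEN null_zero_sets_Int_if_arc] by (simp add: Z null_sets.Un)
  also have "(C \<inter> zero_set M w) \<union> (B \<inter> zero_set M w) = zero_set M w"
    using X by (auto simp: zero_set_def)
  \<comment> \<open>As a vertex, \<open>w\<close> has a zero set of positive measure.\<close>
  finally show False
    using w(1) by (auto simp: comaximal_graph_def comaximal_verts_def)
qed

end
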